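(* Let $X\subseteq\mathbb{R}^m$ and $Y\subseteq\mathbb{R}$ be bounded open sets, $m>1$, let $c\in C^2(\overline X\times\overline Y)$ be twisted and non-degenerate, and let $\mu$ and $\nu$ be probability measures on $X$ and $Y$, absolutely continuous with respect to Lebesgue measure, with $\bar\nu=\frac{d\nu}{dy}$ the density of $\nu$. If for each $y_0\in Y$ we have $$\sup_{y_1\in Y,\ y_1>y_0,\ y_0\le y\le y_1}\left[\frac{D^{min}_\mu(y_0,y_1,k(y_0))}{y_1-y_0}-\bar\nu(y)\right]<0,$$ then $(c,\mu,\nu)$ is nested.
   Context: Twisted: for each $x\in X$ the map $y\mapsto D_xc(x,y)$ is injective on $Y$. Non-degenerate (one-dimensional target): $D^2_{xy}c(x,y)\neq 0$ for all $(x,y)\in\overline X\times\overline Y$. For $y\in Y$ and $k\in\mathbb{R}$: $X_=(y,k)=\{x\in X:\frac{\partial c}{\partial y}(x,y)=k\}$, $X_\ge(y,k)=\{x\in X:\frac{\partial c}{\partial y}(x,y)\ge k\}$, $X_>(y,k)=X_\ge(y,k)\setminus X_=(y,k)$. The mass-splitting level $k(y)\in\mathbb{R}$, $y\in Y$, is defined by $\mu(X_\ge(y,k(y)))=\nu((-\infty,y])$ (if this does not determine $k(y)$ uniquely, $k$ denotes a fixed choice). The model $(c,\mu,\nu)$ is nested if for all $y_0<y_1$ in $Y$: $\nu([y_0,y_1])>0$ implies $X_\ge(y_0,k(y_0))\subseteq X_>(y_1,k(y_1))$. For $y_0<y_1$ in $Y$ and $k_0$ set $k_{max}(y_0,y_1,k_0)=\sup\{k: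 X_\ge(y_0,k_0)\subseteq X_\ge(y_1,k)\}$, and $D^{min}_\mu(y_0,y_1,k_0)=\mu\big(X_\ge(y_1,k_{max}(y_0,y_1,k_0))\setminus X_\ge(y_0,k_0)\big)$ (if $X_\ge(y_0,k_0)=\emptyset$ then $k_{max}=+\infty$ and this quantity is $0$). The density $\bar\nu$ is extended by zero outside $Y$. *)

theory Defs
  imports "HOL-Analysis.Analysis" "HOL-Probability.Probability"
begin

text \<open>
  The class \<open>C\<^sup>2\<close> up to the boundary of an open set \<open>S\<close>: \<open>f\<close> is defined and continuous on
  \<open>closure S\<close>, twice continuously differentiable on \<open>S\<close>, and its first and second derivatives
  extend continuously to \<open>closure S\<close>.
\<close>

definition C2_closure :: "'a::euclidean_space set \<Rightarrow> ('a \<Rightarrow> real) \<Rightarrow> bool" where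
  "C2_closure S f \<longleftrightarrow> continuous_on (closure S) f \<and>
     (\<exists>(f' :: 'a \<Rightarrow> 'a \<Rightarrow>\<^sub>L real) (f'' :: 'a \<Rightarrow> 'a \<Rightarrow>\<^sub>L 'a \<Rightarrow>\<^sub>L real).
        continuous_on (closure S) f' \<and> continuous_on (closure S) f'' \<and>
        (\<forall>z\<in>S. (f has_derivative blinfun_apply (f' z)) (at z) \<and>
               (f' has_derivative blinfun_apply (f'' z)) (at z)))"

definition twisted ::
  "('a::euclidean_space \<Rightarrow> real \<Rightarrow> real) \<Rightarrow> 'a set \<Rightarrow> real set \<Rightarrow> bool" where
  "twisted c X Y \<longleftrightarrow>
     (\<forall>x\<in>X. inj_on (\<lambda>y. frechet_derivative (\<lambda>x'. c x' y) (at x)) Y)"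

definition partial_y :: "('a \<Rightarrow> real \<Rightarrow> real) \<Rightarrow> 'a \<Rightarrow> real \<Rightarrow> real" where
  "partial_y c x y = deriv (\<lambda>y'. c x y') y"

text \<open>
  The mixed derivative at points of \<open>closure X \<times> closure Y\<close> outside \<open>X \<times> Y\<close> is the value of
  the continuous extension \<open>M\<close>, which is unique because \<open>X \<times> Y\<close> is dense in its closure.
\<close>

definition nondegenerate ::
  "('a::euclidean_space \<Rightarrow> real \<Rightarrow> real) \<Rightarrow> 'a set \<Rightarrow> real set \<Rightarrow> bool" where
  "nondegenerate c X Y \<longleftrightarrow>
     (\<exists>M :: 'a \<times> real \<Rightarrow> 'a \<Rightarrow>\<^sub>L real.
        continuous_on (closure X \<times> closure Y) M \<and>
        (\<forall>x\<in>X. \<forall>y\<in>Y.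
           ((\<lambda>x'. partial_y c x' y) has_derivative blinfun_apply (M (x, y))) (at x)) \<and>
        (\<forall>x\<in>closure X. \<forall>y\<in>closure Y. M (x, y) \<noteq> 0))"

text \<open>
  Levels are extended reals, so that the level \<open>k_max = \<infinity>\<close> below is admissible;
  the superlevel set at level \<open>\<infinity>\<close> is empty.
\<close>

definition X_eq :: "('a \<Rightarrow> real \<Rightarrow> real) \<Rightarrow> 'a set \<Rightarrow> real \<Rightarrow> ereal \<Rightarrow> 'a set" where
  "X_eq c X y k = {x \<in> X. ereal (partial_y c x y) = k}"

definition X_ge :: "('a \<Rightarrow> real \<Rightarrow> real) \<Rightarrow> 'a set \<Rightarrow> real \<Rightarrow> ereal \<Rightarrow> 'a set" where
  "X_ge c X y k = {x \<in> X. ereal (partial_y c x y) \<ge> k}"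

definition X_gt :: "('a \<Rightarrow> real \<Rightarrow> real) \<Rightarrow> 'a set \<Rightarrow> real \<Rightarrow> ereal \<Rightarrow> 'a set" where
  "X_gt c X y k = X_ge c X y k - X_eq c X y k"

text \<open>
  The level need not be unique; \<open>mass_splitting \<dots> k\<close> says that \<open>k\<close> is an admissible choice.
\<close>

definition mass_splitting ::
  "('a \<Rightarrow> real \<Rightarrow> real) \<Rightarrow> 'a set \<Rightarrow> real set \<Rightarrow> 'a measure \<Rightarrow> real measure \<Rightarrow> (real \<Rightarrow> real) \<Rightarrow> bool"
  where
  "mass_splitting c X Y \<mu> \<nu> k \<longleftrightarrow>
     (\<forall>y\<in>Y. measure \<mu> (X_ge c X y (ereal (k y))) = measure \<nu> {..y})"

definition nested ::
  "('a \<Rightarrow> real \<Rightarrow> real) \<Rightarrow> 'a set \<Rightarrow> real set \<Rightarrow> real measure \<Rightarrow> (real \<Rightarrow> real) \<Rightarrow> bool"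
  where
  "nested c X Y \<nu> k \<longleftrightarrow>
     (\<forall>y0\<in>Y. \<forall>y1\<in>Y. y0 < y1 \<longrightarrow> measure \<nu> {y0..y1} > 0 \<longrightarrow>
        X_ge c X y0 (ereal (k y0)) \<subseteq> X_gt c X y1 (ereal (k y1)))"

definition k_max :: "('a \<Rightarrow> real \<Rightarrow> real) \<Rightarrow> 'a set \<Rightarrow> real \<Rightarrow> real \<Rightarrow> real \<Rightarrow> ereal" where
  "k_max c X y0 y1 k0 =
     Sup {ereal k | k :: real. X_ge c X y0 (ereal k0) \<subseteq> X_ge c X y1 (ereal k)}"

definition D_min ::
  "('a \<Rightarrow> real \<Rightarrow> real) \<Rightarrow> 'a set \<Rightarrow> 'a measure \<Rightarrow> real \<Rightarrow> real \<Rightarrow> real \<Rightarrow> real" where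
  "D_min c X \<mu> y0 y1 k0 =
     measure \<mu> (X_ge c X y1 (k_max c X y0 y1 k0) - X_ge c X y0 (ereal k0))"

end

theory Submission
  imports Defs
begin

text \<open>
  The supremum condition makes \<open>\<nu>\<close> have mass larger than \<open>D_min\<close> on \<open>(y\<^sub>0, y\<^sub>1]\<close>. Since the
  supremum defining \<open>k_max\<close> is attained, this means
  \<open>\<mu> (X\<^sub>\<ge>(y\<^sub>1, k_max)) = \<mu> (X\<^sub>\<ge>(y\<^sub>0, k(y\<^sub>0))) + D_min < \<nu> (-\<infinity>, y\<^sub>1] = \<mu> (X\<^sub>\<ge>(y\<^sub>1, k(y\<^sub>1)))\<close>,
  so \<open>k(y\<^sub>1) < k_max\<close> and the superlevel set at \<open>k_max\<close> lies strictly above level \<open>k(y\<^sub>1)\<close>.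
\<close>

lemma X_ge_antimono:
  assumes "k1 \<le> k2"
  shows "X_ge c X y k2 \<subseteq> X_ge c X y k1"
  using assms by (auto simp: X_ge_def)

lemma X_ge_subset_X_gt:
  assumes "k1 < k2"
  shows "X_ge c X y k2 \<subseteq> X_gt c X y k1"
  using assms by (auto simp: X_ge_def X_gt_def X_eq_def)

text \<open>The supremum in \<open>k_max\<close> is attained: each point \<open>x\<close> of the
  left-hand set bounds every admissible level by \<open>partial_y c x y1\<close>, hence bounds their
  supremum too. If that set is empty, the level is infinite and the inclusion is trivial.\<close>

lemma X_ge_subset_X_ge_k_max:
  "X_ge c X y0 (ereal k0) \<subseteq> X_ge c X y1 (k_max c X y0 y1 k0)"
proof
  fix x assume x: "x \<in> X_ge c X y0 (ereal k0)"
  have "k_max c X y0 y1 k0 \<le> ereal (partial_y c x y1)"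
    unfolding k_max_def using x by (intro Sup_least) (auto simp: X_ge_def)
  with x show "x \<in> X_ge c X y1 (k_max c X y0 y1 k0)"
    by (simp add: X_ge_def)
qed

lemma nondegenerate_continuous_on:
  assumes "nondegenerate c X Y" and "y \<in> Y"
  shows "continuous_on X (\<lambda>x. partial_y c x y)"
  using assms unfolding nondegenerate_def
  by (metis continuous_at_imp_continuous_on has_derivative_continuous)

text \<open>Measurability is checked in the subspace \<open>X\<close>, since continuity of
  \<open>partial_y\<close> is known only there. Openness of \<open>X\<close> then makes the set
  Borel in the whole space.\<close>

lemma X_ge_borel:
  assumes "open X" and "continuous_on X (\<lambda>x. partial_y c x y)"
  shows "X_ge c X y k \<in> sets borel"
proof -
  have "{x \<in> space (restrict_space borel X). k \<le> ereal (partial_y c x y)}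
      \<in> sets (restrict_space borel X)"
    using borel_measurable_continuous_on_restrict[OF assms(2)] by measurable
  moreover have "X \<in> sets borel"
    using assms(1) by simp
  ultimately show ?thesis
    by (simp add: sets_restrict_space_iff X_ge_def space_restrict_space)
qed

lemma measure_X_ge_k_max:
  assumes "finite_measure \<mu>" and "X_ge c X y0 (ereal k0) \<in> sets \<mu>"
    and "X_ge c X y1 (k_max c X y0 y1 k0) \<in> sets \<mu>"
  shows "measure \<mu> (X_ge c X y1 (k_max c X y0 y1 k0)) =
    measure \<mu> (X_ge c X y0 (ereal k0)) + D_min c X \<mu> y0 y1 k0"
  using finite_measure.finite_measure_Diff[OF assms(1,3,2) X_ge_subset_X_ge_k_max]
  by (simp add: D_min_def)

text \<open>The interval is half-open so that it is disjoint from \<open>{..a}\<close> and completes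
  it to \<open>{..b}\<close>.\<close>

lemma measure_density_interval_ge:
  fixes f :: "real \<Rightarrow> real"
  assumes f: "f \<in> borel_measurable borel"
    and fin: "finite_measure (density lborel (\<lambda>y. ennreal (f y)))"
    and "a \<le> b" and "0 \<le> r" and le: "\<And>y. y \<in> {a<..b} \<Longrightarrow> r \<le> f y"
  shows "r * (b - a) \<le> measure (density lborel (\<lambda>y. ennreal (f y))) {a<..b}"
proof -
  have "ennreal (r * (b - a)) = (\<integral>\<^sup>+y. ennreal r * indicator {a<..b} y \<partial>lborel)"
    using assms by (simp add: nn_integral_cmult_indicator ennreal_mult)
  also have "\<dots> \<le> (\<integral>\<^sup>+y. ennreal (f y) * indicator {a<..b} y \<partial>lborel)"
    using le by (intro nn_integral_mono) (auto simp: indicator_def intro: ennreal_leI)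
  also have "\<dots> = emeasure (density lborel (\<lambda>y. ennreal (f y))) {a<..b}"
    using f by (subst emeasure_density) auto
  finally show ?thesis
    by (simp add: finite_measure.emeasure_eq_measure[OF fin])
qed

theorem corollary4:
  fixes X :: "(real ^ 'm) set" and Y :: "real set"
    and c :: "real ^ 'm \<Rightarrow> real \<Rightarrow> real"
    and \<mu> :: "(real ^ 'm) measure" and \<nu> :: "real measure"
    and nubar :: "real \<Rightarrow> real" and k :: "real \<Rightarrow> real"
  assumes "CARD('m) > 1"
    and "open X" and "bounded X"
    and "open Y" and "bounded Y"
    and "C2_closure (X \<times> Y) (\<lambda>(x, y). c x y)"
    and "twisted c X Y"
    and "nondegenerate c X Y"
    and "prob_space \<mu>" and "sets \<mu> = sets borel" and "measure \<mu> X = 1"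
    and "absolutely_continuous lborel \<mu>"
    and "prob_space \<nu>" and "sets \<nu> = sets borel" and "measure \<nu> Y = 1"
    and "absolutely_continuous lborel \<nu>"
    and "nubar \<in> borel_measurable borel" and "\<And>y. nubar y \<ge> 0"
    and "\<And>y. y \<notin> Y \<Longrightarrow> nubar y = 0"
    and "\<nu> = density lborel (\<lambda>y. ennreal (nubar y))"
    and "mass_splitting c X Y \<mu> \<nu> k"
    and "\<And>y0. y0 \<in> Y \<Longrightarrow>
      (SUP (y1, y) \<in> {(y1, y). y1 \<in> Y \<and> y1 > y0 \<and> y0 \<le> y \<and> y \<le> y1}.
         ereal (D_min c X \<mu> y0 y1 (k y0) / (y1 - y0) - nubar y)) < 0"
  shows "nested c X Y \<nu> k"
proof -
  interpret \<mu>: prob_space \<mu> by fact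
  interpret \<nu>: prob_space \<nu> by fact
  have "X_ge c X y0 (ereal (k y0)) \<subseteq> X_gt c X y1 (ereal (k y1))"
    if y: "y0 \<in> Y" "y1 \<in> Y" "y0 < y1" for y0 y1
  proof -
    define D where "D = D_min c X \<mu> y0 y1 (k y0)"
    define K where "K = k_max c X y0 y1 (k y0)"
    have X_ge_sets: "X_ge c X y l \<in> sets \<mu>" if "y \<in> Y" for y l
      using X_ge_borel nondegenerate_continuous_on assms(2,8,10) that by metis
    have splitting: "measure \<mu> (X_ge c X y (ereal (k y))) = measure \<nu> {..y}" if "y \<in> Y" for y
      using assms(21) that by (simp add: mass_splitting_def)
    \<comment> \<open>A real number strictly between the supremum and 0 gives a gap that is uniform
      in \<open>y\<close>, so strictness survives integration over the interval.\<close>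
    obtain r where "r < 0" and
      r: "(SUP (y1, y) \<in> {(y1, y). y1 \<in> Y \<and> y1 > y0 \<and> y0 \<le> y \<and> y \<le> y1}.
         ereal (D_min c X \<mu> y0 y1 (k y0) / (y1 - y0) - nubar y)) < ereal r"
      using ereal_dense2[OF assms(22)[OF y(1)]] by auto
    have bound: "D / (y1 - y0) - r \<le> nubar y" if "y \<in> {y0<..y1}" for y
    proof -
      have "ereal (D / (y1 - y0) - nubar y) \<le>
        (SUP (y1, y) \<in> {(y1, y). y1 \<in> Y \<and> y1 > y0 \<and> y0 \<le> y \<and> y \<le> y1}.
         ereal (D_min c X \<mu> y0 y1 (k y0) / (y1 - y0) - nubar y))"
        unfolding D_def using y that by (intro SUP_upper2[of "(y1, y)"]) auto
      with r have "ereal (D / (y1 - y0) - nubar y) < ereal r"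
        by (rule order.strict_trans1[rotated])
      then show ?thesis by simp
    qed
    \<comment> \<open>With \<open>r < 0\<close> this makes the constant
      \<open>D / (y1 - y0) - r\<close> nonnegative, as the integral bound requires.\<close>
    have "D \<ge> 0"
      by (simp add: D_def D_min_def)
    \<comment> \<open>The two sides differ by \<open>- r * (y1 - y0)\<close>, which is
      positive.\<close>
    have "D < (D / (y1 - y0) - r) * (y1 - y0)"
      using \<open>r < 0\<close> y(3) by (simp add: left_diff_distrib mult_neg_pos)
    also have "\<dots> \<le> measure \<nu> {y0<..y1}"
      using \<open>r < 0\<close> \<open>D \<ge> 0\<close> y(3) bound \<nu>.finite_measure_axioms
      unfolding assms(20) by (intro measure_density_interval_ge assms(17))
        (auto intro: less_imp_le order_trans[of _ 0])
    finally have "measure \<nu> {..y0} + D < measure \<nu> ({..y0} \<union> {y0<..y1})"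
      using assms(14) by (subst \<nu>.finite_measure_Union) auto
    also have "{..y0} \<union> {y0<..y1} = {..y1}"
      using y(3) by auto
    finally have "measure \<mu> (X_ge c X y1 K) < measure \<mu> (X_ge c X y1 (ereal (k y1)))"
      using measure_X_ge_k_max[OF \<mu>.finite_measure_axioms X_ge_sets[OF y(1)] X_ge_sets[OF y(2)]]
      by (simp add: splitting y K_def D_def)
    then have "\<not> X_ge c X y1 (ereal (k y1)) \<subseteq> X_ge c X y1 K"
      using \<mu>.finite_measure_mono[OF _ X_ge_sets[OF y(2)]] by (meson not_le)
    \<comment> \<open>Superlevel sets shrink as the level rises, so
      \<open>K \<le> ereal (k y1)\<close> would give the inclusion just excluded. This covers an
      infinite \<open>K\<close> and any admissible choice of \<open>k\<close>.\<close>
    then have "ereal (k y1) < K"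
      using X_ge_antimono not_le by metis
    then show ?thesis
      using X_ge_subset_X_ge_k_max X_ge_subset_X_gt unfolding K_def by (metis subset_trans)
  qed
  then show ?thesis
    by (simp add: nested_def)
qed

end
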